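(* Let $n\ge1$. For any sequent $S'$, put $X_{S'}:=\bigcup_{j\le n}\Box^j\{\chi\in\mathrm{Sub}(S')\mid[\chi]_{\mathrm{mod}}=[0]_n\}$. Let $R$ be a rule of $\mathcal{G}^\infty_{\mathrm{mod}}\mathsf{wGL}_n$ and let $(S_0,\ldots,S_{m-1},S)$ be an instance of $R$ with premises $S_0,\ldots,S_{m-1}$ and conclusion $S$. If $S\subseteq X_{S'}$, then $S_i\subseteq X_{S'}$ for each $i<m$.
   Context: Formulas are built from a countably infinite set $\mathrm{Var}$ of propositional variables by $\phi::=p\mid\bot\mid\phi\to\phi\mid\Box\phi$; $\Box^0\phi:=\phi$, $\Box^{m+1}\phi:=\Box\Box^m\phi$. $\mathrm{Sub}(\phi)$ is the usual set of subformulas of $\phi$ (including $\phi$). A sequent $\Gamma\Rightarrow\Delta$ is an ordered pair of finite multisets of formulas; $\mathrm{Sub}(\Gamma\Rightarrow\Delta)$ is the union of $\mathrm{Sub}(\phi)$ over all formulas $\phi$ in $\Gamma$ or $\Delta$. For a sequent $S$ and a set of formulas $X$, $S\subseteq X$ means that every formula occurring on the left or right side of $S$ belongs to $X$. For a set or multiset $\Sigma$, $\Box^m\Sigma$ is obtained by prefixing each element with $\Box^m$, and $\boxdot^n\Sigma$ denotes the multiset $\Box^n\Sigma,\Sigma$. The modal modulus $[\phi]_{\mathrm{mod}}\in\mathbb{Z}/n\mathbb{Z}$ is defined by $[p]_{\mathrm{mod}}=[\bot]_{\mathrm{mod}}=[\phi_0\to\phi_1]_{\mathrm{mod}}=[0]_n$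 and $[\Box\phi_0]_{\mathrm{mod}}=[\phi_0]_{\mathrm{mod}}+[1]_n$. The rules of $\mathcal{G}^\infty_{\mathrm{mod}}\mathsf{wGL}_n$ are ($p\in\mathrm{Var}$, all multisets arbitrary and finite): (ax) conclude $p,\Gamma\Rightarrow p,\Delta$ from no premises; ($\bot$L) conclude $\bot,\Gamma\Rightarrow\Delta$ from no premises; ($\bot$R) from $\Gamma\Rightarrow\Delta$ infer $\Gamma\Rightarrow\bot,\Delta$; ($\to$L) from $\Gamma\Rightarrow\phi,\Delta$ and $\psi,\Gamma\Rightarrow\Delta$ infer $\phi\to\psi,\Gamma\Rightarrow\Delta$; ($\to$R) from $\phi,\Gamma\Rightarrow\psi,\Delta$ infer $\Gamma\Rightarrow\phi\to\psi,\Delta$; ($\Box^{\mathsf{wK4}_n}_{\mathrm{mod}}$) from $\boxdot^n\Sigma_0,\Box^1\Sigma_1,\ldots,\Box^{n-1}\Sigma_{n-1}\Rightarrow\phi$ infer $\Box^1\Sigma_0,\Box^2\Sigma_1,\ldots,\Box^n\Sigma_{n-1},\Gamma\Rightarrow\Box\phi,\Delta$, where every formula in every $\Sigma_i$ ($i<n$) has modal modulus $[0]_n$. *)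

theory Defs
  imports "HOL-Library.Multiset"
begin

text \<open>The countably infinite set of propositional variables is the type \<open>nat\<close>.\<close>

datatype fm = Var nat | Bot | Imp fm fm (infixr \<open>\<rightarrow>\<^sub>f\<close> 70) | Box fm

text \<open>The iterated box is \<open>Box ^^ m\<close>; on multisets and sets it acts elementwise.\<close>

abbreviation box_mset :: "nat \<Rightarrow> fm multiset \<Rightarrow> fm multiset" where
  "box_mset m \<Sigma> \<equiv> image_mset (Box ^^ m) \<Sigma>"

definition boxdot_mset :: "nat \<Rightarrow> fm multiset \<Rightarrow> fm multiset" where
  "boxdot_mset n \<Sigma> = box_mset n \<Sigma> + \<Sigma>"

primrec Sub :: "fm \<Rightarrow> fm set" where
  "Sub (Var p) = {Var p}"
| "Sub Bot = {Bot}"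
| "Sub (\<phi> \<rightarrow>\<^sub>f \<psi>) = insert (\<phi> \<rightarrow>\<^sub>f \<psi>) (Sub \<phi> \<union> Sub \<psi>)"
| "Sub (Box \<phi>) = insert (Box \<phi>) (Sub \<phi>)"

text \<open>For \<open>n \<ge> 1\<close>, an element of \<open>\<int>/n\<int>\<close> is represented by its canonical representative in
  \<open>{0..<n}\<close>; in particular the class of \<open>0\<close> is \<open>0\<close>.\<close>

primrec modulus :: "nat \<Rightarrow> fm \<Rightarrow> nat" where
  "modulus n (Var p) = 0"
| "modulus n Bot = 0"
| "modulus n (\<phi> \<rightarrow>\<^sub>f \<psi>) = 0"
| "modulus n (Box \<phi>) = (modulus n \<phi> + 1) mod n"

datatype sequent = Sequent (lhs: "fm multiset") (rhs: "fm multiset") (infix \<open>\<Rightarrow>\<^sub>s\<close> 50)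

definition fms_of :: "sequent \<Rightarrow> fm set" where
  "fms_of S = set_mset (lhs S) \<union> set_mset (rhs S)"

definition Sub_seq :: "sequent \<Rightarrow> fm set" where
  "Sub_seq S = (\<Union>\<phi>\<in>fms_of S. Sub \<phi>)"

definition seq_subset :: "sequent \<Rightarrow> fm set \<Rightarrow> bool" (infix \<open>\<subseteq>\<^sub>s\<close> 50) where
  "S \<subseteq>\<^sub>s X \<longleftrightarrow> (\<forall>\<phi>\<in>fms_of S. \<phi> \<in> X)"

datatype wGL_rule = Ax | BotL | BotR | ImpL | ImpR | BoxMod

text \<open>\<open>rule_instance n R Ss S\<close>: the premises \<open>Ss\<close> (in order) and the conclusion \<open>S\<close> form an instance
  of the rule \<open>R\<close> of the calculus for \<open>n\<close>.\<close>

inductive rule_instance :: "nat \<Rightarrow> wGL_rule \<Rightarrow> sequent list \<Rightarrow> sequent \<Rightarrow> bool" for n :: nat where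
  ax: "rule_instance n Ax [] (add_mset (Var p) \<Gamma> \<Rightarrow>\<^sub>s add_mset (Var p) \<Delta>)"
| botL: "rule_instance n BotL [] (add_mset Bot \<Gamma> \<Rightarrow>\<^sub>s \<Delta>)"
| botR: "rule_instance n BotR [\<Gamma> \<Rightarrow>\<^sub>s \<Delta>] (\<Gamma> \<Rightarrow>\<^sub>s add_mset Bot \<Delta>)"
| impL: "rule_instance n ImpL [\<Gamma> \<Rightarrow>\<^sub>s add_mset \<phi> \<Delta>, add_mset \<psi> \<Gamma> \<Rightarrow>\<^sub>s \<Delta>]
           (add_mset (\<phi> \<rightarrow>\<^sub>f \<psi>) \<Gamma> \<Rightarrow>\<^sub>s \<Delta>)"
| impR: "rule_instance n ImpR [add_mset \<phi> \<Gamma> \<Rightarrow>\<^sub>s add_mset \<psi> \<Delta>]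
           (\<Gamma> \<Rightarrow>\<^sub>s add_mset (\<phi> \<rightarrow>\<^sub>f \<psi>) \<Delta>)"
| boxMod: "(\<forall>i<n. \<forall>\<chi>\<in>#\<Sigma> i. modulus n \<chi> = 0) \<Longrightarrow>
     rule_instance n BoxMod
       [boxdot_mset n (\<Sigma> 0) + (\<Sum>i = 1..<n. box_mset i (\<Sigma> i)) \<Rightarrow>\<^sub>s {#\<phi>#}]
       ((\<Sum>i<n. box_mset (i + 1) (\<Sigma> i)) + \<Gamma> \<Rightarrow>\<^sub>s add_mset (Box \<phi>) \<Delta>)"

definition closure_set :: "nat \<Rightarrow> sequent \<Rightarrow> fm set" where
  "closure_set n S' = (\<Union>j\<le>n. (Box ^^ j) ` {\<chi> \<in> Sub_seq S'. modulus n \<chi> = 0})"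

end

theory Submission
  imports Defs
begin

text \<open>
  Write \<open>X\<close> for the set \<open>closure_set n S'\<close>. It is enough that \<open>X\<close> has the following closure
  properties, each of which covers one kind of premise formula.

  \<^item> \<open>Sub_seq S' \<subseteq> X\<close>: taking the largest multiple of \<open>n\<close> among the leading boxes, every formula is
    \<open>Box ^^ j\<close> of a subformula of modulus \<open>0\<close> with \<open>j < n\<close>. An implication in \<open>X\<close> cannot carry an
    outer box, so it lies in \<open>Sub_seq S'\<close>; then so do its two sides, which are therefore in \<open>X\<close>.

  \<^item> \<open>X\<close> is closed under removing an outer box: this lowers the exponent \<open>j\<close>, or else passes to a
    proper subformula.

  \<^item> If \<open>Box \<sigma> \<in> X\<close> and \<open>\<sigma>\<close> has modulus \<open>0\<close>, then \<open>Box ^^ n \<sigma> \<in> X\<close>. This is needed because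
    \<open>boxdot_mset\<close> puts new boxes in the premise of the modal rule. The modulus leaves no choice
    but \<open>\<sigma> \<in> Sub_seq S'\<close>, and the bound \<open>j \<le> n\<close> in \<open>X\<close> is just enough for the \<open>n\<close> boxes.
\<close>

lemma Sub_refl: "\<phi> \<in> Sub \<phi>"
  by (cases \<phi>) auto

lemma Sub_trans: "\<psi> \<in> Sub \<phi> \<Longrightarrow> Sub \<psi> \<subseteq> Sub \<phi>"
  by (induction \<phi>) auto

lemma Sub_seq_closed: "\<phi> \<in> Sub_seq S \<Longrightarrow> \<psi> \<in> Sub \<phi> \<Longrightarrow> \<psi> \<in> Sub_seq S"
  unfolding Sub_seq_def using Sub_trans by blast

lemma modulus_funpow_Box:
  assumes "modulus n \<chi> = 0"
  shows "modulus n ((Box ^^ k) \<chi>) = k mod n"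
  using assms by (induction k) (simp_all add: mod_Suc_eq)

lemma ex_modulus_0_subformula:
  assumes "n \<ge> 1"
  shows "\<exists>j<n. \<exists>\<chi>\<in>Sub \<phi>. modulus n \<chi> = 0 \<and> \<phi> = (Box ^^ j) \<chi>"
proof (induction \<phi>)
  case (Box \<phi>)
  then obtain j \<chi> where j: "j < n" "\<chi> \<in> Sub \<phi>" "modulus n \<chi> = 0" "\<phi> = (Box ^^ j) \<chi>"
    by blast
  show ?case
  proof (cases "Suc j < n")
    case True
    with j show ?thesis by (intro exI[of _ "Suc j"]) auto
  next
    \<comment> \<open>A full block of \<open>n\<close> boxes has modulus \<open>0\<close>, so the count starts afresh.\<close>
    case False
    with j(1) have "Suc j = n" by simp
    with j(3,4) have "modulus n (Box \<phi>) = 0"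
      by (simp add: modulus_funpow_Box)
    with assms show ?thesis by (intro exI[of _ 0]) auto
  qed
qed (use assms in \<open>auto intro!: exI[of _ 0]\<close>)

lemma closure_setI:
  "\<chi> \<in> Sub_seq S \<Longrightarrow> modulus n \<chi> = 0 \<Longrightarrow> j \<le> n \<Longrightarrow> (Box ^^ j) \<chi> \<in> closure_set n S"
  unfolding closure_set_def by blast

lemma closure_setE:
  assumes "\<phi> \<in> closure_set n S"
  obtains j \<chi> where "j \<le> n" "\<chi> \<in> Sub_seq S" "modulus n \<chi> = 0" "\<phi> = (Box ^^ j) \<chi>"
  using assms unfolding closure_set_def by blast

lemma Sub_seq_subset_closure_set:
  assumes "n \<ge> 1"
  shows "Sub_seq S \<subseteq> closure_set n S"
proof
  fix \<phi> assume \<phi>: "\<phi> \<in> Sub_seq S"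
  obtain j \<chi> where "j < n" "\<chi> \<in> Sub \<phi>" "modulus n \<chi> = 0" and eq: "\<phi> = (Box ^^ j) \<chi>"
    using ex_modulus_0_subformula[OF assms] by blast
  with \<phi> show "\<phi> \<in> closure_set n S"
    unfolding eq by (intro closure_setI) (auto intro: Sub_seq_closed)
qed

lemma closure_set_ImpD:
  assumes "n \<ge> 1" and "\<phi> \<rightarrow>\<^sub>f \<psi> \<in> closure_set n S"
  shows "\<phi> \<in> closure_set n S" and "\<psi> \<in> closure_set n S"
proof -
  from assms(2) obtain j \<chi> where "\<chi> \<in> Sub_seq S" "\<phi> \<rightarrow>\<^sub>f \<psi> = (Box ^^ j) \<chi>"
    by (rule closure_setE)
  then have "\<phi> \<rightarrow>\<^sub>f \<psi> \<in> Sub_seq S"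
    by (cases j) auto
  then have "\<phi> \<in> Sub_seq S" "\<psi> \<in> Sub_seq S"
    by (auto elim!: Sub_seq_closed simp: Sub_refl)
  then show "\<phi> \<in> closure_set n S" "\<psi> \<in> closure_set n S"
    using Sub_seq_subset_closure_set[OF assms(1)] by auto
qed

lemma closure_set_BoxD:
  assumes "n \<ge> 1" and "Box \<phi> \<in> closure_set n S"
  shows "\<phi> \<in> closure_set n S"
proof -
  from assms(2) obtain j \<chi>
    where j: "j \<le> n" "\<chi> \<in> Sub_seq S" "modulus n \<chi> = 0" "Box \<phi> = (Box ^^ j) \<chi>"
    by (rule closure_setE)
  show ?thesis
  proof (cases j)
    case 0
    with j have "\<phi> \<in> Sub_seq S"
      by (auto elim!: Sub_seq_closed simp: Sub_refl)
    then show ?thesis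
      using Sub_seq_subset_closure_set[OF assms(1)] by auto
  next
    case (Suc i)
    with j show ?thesis
      using closure_setI[of \<chi> S n i] by simp
  qed
qed

text \<open>If \<open>Box \<sigma> = (Box ^^ Suc i) \<chi>\<close> with \<open>\<chi>\<close> of modulus \<open>0\<close>, comparing moduli gives \<open>i mod n = 0\<close>;
  as \<open>i < n\<close>, this forces \<open>\<sigma> = \<chi>\<close>. Without the hypothesis on the modulus of \<open>\<sigma>\<close>, the formula
  \<open>(Box ^^ n) \<sigma>\<close> could have too many boxes above the formulas of \<open>Sub_seq S\<close>.\<close>

lemma closure_set_Box_modulus_0D:
  assumes "Box \<sigma> \<in> closure_set n S" and "modulus n \<sigma> = 0"
  shows "(Box ^^ n) \<sigma> \<in> closure_set n S"
proof -
  from assms(1) obtain j \<chi>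
    where j: "j \<le> n" "\<chi> \<in> Sub_seq S" "modulus n \<chi> = 0" "Box \<sigma> = (Box ^^ j) \<chi>"
    by (rule closure_setE)
  have "\<sigma> \<in> Sub_seq S"
  proof (cases j)
    case 0
    with j show ?thesis
      by (auto elim!: Sub_seq_closed simp: Sub_refl)
  next
    case (Suc i)
    with j have \<sigma>: "\<sigma> = (Box ^^ i) \<chi>" by simp
    with assms(2) j(3) have "i mod n = 0"
      using modulus_funpow_Box by metis
    with Suc j(1) have "i = 0" by simp
    with \<sigma> j(2) show ?thesis by simp
  qed
  with assms(2) show ?thesis
    by (simp add: closure_setI)
qed

theorem mainTheorem5:
  fixes n :: nat and S' S :: sequent and R :: wGL_rule and Ss :: "sequent list"
  assumes "n \<ge> 1"
    and "rule_instance n R Ss S"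
    and "S \<subseteq>\<^sub>s closure_set n S'"
  shows "\<forall>i<length Ss. Ss ! i \<subseteq>\<^sub>s closure_set n S'"
proof -
  let ?X = "closure_set n S'"
  have "\<forall>T\<in>set Ss. T \<subseteq>\<^sub>s ?X"
    using assms(2)
  proof cases
    case (boxMod \<Sigma> \<phi> \<Gamma> \<Delta>)
    have Box_\<phi>: "Box \<phi> \<in> ?X"
      using assms(3) boxMod(3) by (simp add: seq_subset_def fms_of_def)
    have Box_\<Sigma>: "Box ((Box ^^ i) \<sigma>) \<in> ?X" if "i < n" "\<sigma> \<in># \<Sigma> i" for i \<sigma>
      using assms(3) boxMod(3) that
      by (force simp: seq_subset_def fms_of_def set_mset_sum)
    have \<Sigma>: "(Box ^^ i) \<sigma> \<in> ?X" if "i < n" "\<sigma> \<in># \<Sigma> i" for i \<sigma>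
      using closure_set_BoxD[OF assms(1) Box_\<Sigma>[OF that]] .
    have \<Sigma>0: "\<sigma> \<in> ?X" "(Box ^^ n) \<sigma> \<in> ?X" if "\<sigma> \<in># \<Sigma> 0" for \<sigma>
      using \<Sigma>[of 0 \<sigma>] Box_\<Sigma>[of 0 \<sigma>] that assms(1) boxMod(4)
      by (auto intro: closure_set_Box_modulus_0D)
    show ?thesis
      using \<Sigma> \<Sigma>0 closure_set_BoxD[OF assms(1) Box_\<phi>] boxMod(2)
      by (auto simp: seq_subset_def fms_of_def boxdot_mset_def set_mset_sum)
  qed (use assms(3) in \<open>auto simp: seq_subset_def fms_of_def dest: closure_set_ImpD[OF assms(1)]\<close>)
  then show ?thesis by simp
qed

end
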